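(* Let $\mathcal{A}$ be an abelian category with a generator, small direct sums and exact small products. The class of local inverse sequences in $\mathcal{A}$ is closed with respect to small limits (taken in the category $\mathcal{A}^{\omega^{\mathrm{op}}}$ of inverse sequences).
   Context: A generator of $\mathcal{A}$ is an object $G$ such that the functor $\mathcal{A}(G,-)$ is faithful. An inverse sequence $S$ in $\mathcal{A}$ consists of objects $S_i$ and morphisms $f_i:S_{i+1}\to S_i$, $i\in\omega=\{0,1,2,\dots\}$, i.e. it is a functor $\omega^{\mathrm{op}}\to\mathcal{A}$. The objects $\lim S$ and $\lim^1 S$ (the limit and its first right derived functor) are the kernel and the cokernel of $1-F:\prod_i S_i\to\prod_i S_i$, where $\mathrm{pr}_jF=f_j\,\mathrm{pr}_{j+1}$. $S$ is called local if $\lim S=\lim^1 S=0$. *)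

theory Defs
  imports "HOL-Algebra.Group"
begin

unbundle cardinal_syntax

section \<open>Smallness\<close>

text \<open>
  HOL has no distinction between sets and classes, so smallness is relative to a cardinal
  \<open>\<kappa>\<close>: a set is small if it has fewer than \<open>\<kappa>\<close> elements. We only ask that \<open>\<kappa>\<close> is uncountable
  and regular. The cardinalities of Grothendieck universes are the special case in which \<open>\<kappa>\<close>
  is moreover a strong limit.
\<close>

definition smallness_cardinal :: "'u rel \<Rightarrow> bool" where
  "smallness_cardinal \<kappa> \<longleftrightarrow> Card_order \<kappa> \<and> regularCard \<kappa> \<and> natLeq <o \<kappa>"

definition small :: "'u rel \<Rightarrow> 'a set \<Rightarrow> bool" where
  "small \<kappa> A \<longleftrightarrow> |A| <o \<kappa>"


section \<open>Categories, functors, limits\<close>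

record ('o, 'm) cat =
  Ob :: "'o set"
  Arr :: "'m set"
  Dom :: "'m \<Rightarrow> 'o"
  Cod :: "'m \<Rightarrow> 'o"
  Idt :: "'o \<Rightarrow> 'm"
  Comp :: "'m \<Rightarrow> 'm \<Rightarrow> 'm" (infixl "\<cdot>\<index>" 70)

definition Hom :: "('o, 'm, 'z) cat_scheme \<Rightarrow> 'o \<Rightarrow> 'o \<Rightarrow> 'm set" where
  "Hom C X Y = {f \<in> Arr C. Dom C f = X \<and> Cod C f = Y}"

definition category :: "('o, 'm, 'z) cat_scheme \<Rightarrow> bool" where
  "category C \<longleftrightarrow>
    (\<forall>f \<in> Arr C. Dom C f \<in> Ob C \<and> Cod C f \<in> Ob C) \<and>
    (\<forall>X \<in> Ob C. Idt C X \<in> Hom C X X) \<and>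
    (\<forall>X Y Z f g. f \<in> Hom C X Y \<longrightarrow> g \<in> Hom C Y Z \<longrightarrow> g \<cdot>\<^bsub>C\<^esub> f \<in> Hom C X Z) \<and>
    (\<forall>X Y f. f \<in> Hom C X Y \<longrightarrow> f \<cdot>\<^bsub>C\<^esub> Idt C X = f \<and> Idt C Y \<cdot>\<^bsub>C\<^esub> f = f) \<and>
    (\<forall>W X Y Z f g h. f \<in> Hom C W X \<longrightarrow> g \<in> Hom C X Y \<longrightarrow> h \<in> Hom C Y Z \<longrightarrow>
       (h \<cdot>\<^bsub>C\<^esub> g) \<cdot>\<^bsub>C\<^esub> f = h \<cdot>\<^bsub>C\<^esub> (g \<cdot>\<^bsub>C\<^esub> f))"

definition small_category :: "'u rel \<Rightarrow> ('o, 'm, 'z) cat_scheme \<Rightarrow> bool" where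
  "small_category \<kappa> J \<longleftrightarrow> category J \<and> small \<kappa> (Ob J) \<and> small \<kappa> (Arr J)"

definition is_functor ::
  "('j, 'k, 'y) cat_scheme \<Rightarrow> ('o, 'm, 'z) cat_scheme \<Rightarrow> ('j \<Rightarrow> 'o) \<Rightarrow> ('k \<Rightarrow> 'm) \<Rightarrow> bool" where
  "is_functor J C D\<^sub>o D\<^sub>a \<longleftrightarrow>
    (\<forall>j \<in> Ob J. D\<^sub>o j \<in> Ob C) \<and>
    (\<forall>i j a. a \<in> Hom J i j \<longrightarrow> D\<^sub>a a \<in> Hom C (D\<^sub>o i) (D\<^sub>o j)) \<and>
    (\<forall>j \<in> Ob J. D\<^sub>a (Idt J j) = Idt C (D\<^sub>o j)) \<and>
    (\<forall>i j k a b. a \<in> Hom J i j \<longrightarrow> b \<in> Hom J j k \<longrightarrow> D\<^sub>a (b \<cdot>\<^bsub>J\<^esub> a) = D\<^sub>a b \<cdot>\<^bsub>C\<^esub> D\<^sub>a a)"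

definition is_cone ::
  "('j, 'k, 'y) cat_scheme \<Rightarrow> ('o, 'm, 'z) cat_scheme \<Rightarrow> ('j \<Rightarrow> 'o) \<Rightarrow> ('k \<Rightarrow> 'm) \<Rightarrow>
    'o \<Rightarrow> ('j \<Rightarrow> 'm) \<Rightarrow> bool" where
  "is_cone J C D\<^sub>o D\<^sub>a L l \<longleftrightarrow>
    L \<in> Ob C \<and> (\<forall>j \<in> Ob J. l j \<in> Hom C L (D\<^sub>o j)) \<and>
    (\<forall>i j a. a \<in> Hom J i j \<longrightarrow> D\<^sub>a a \<cdot>\<^bsub>C\<^esub> l i = l j)"

definition is_limit_cone ::
  "('j, 'k, 'y) cat_scheme \<Rightarrow> ('o, 'm, 'z) cat_scheme \<Rightarrow> ('j \<Rightarrow> 'o) \<Rightarrow> ('k \<Rightarrow> 'm) \<Rightarrow>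
    'o \<Rightarrow> ('j \<Rightarrow> 'm) \<Rightarrow> bool" where
  "is_limit_cone J C D\<^sub>o D\<^sub>a L l \<longleftrightarrow>
    is_cone J C D\<^sub>o D\<^sub>a L l \<and>
    (\<forall>M m. is_cone J C D\<^sub>o D\<^sub>a M m \<longrightarrow> (\<exists>!h. h \<in> Hom C M L \<and> (\<forall>j \<in> Ob J. l j \<cdot>\<^bsub>C\<^esub> h = m j)))"

definition is_product ::
  "('o, 'm, 'z) cat_scheme \<Rightarrow> 'i set \<Rightarrow> ('i \<Rightarrow> 'o) \<Rightarrow> 'o \<Rightarrow> ('i \<Rightarrow> 'm) \<Rightarrow> bool" where
  "is_product C I X P p \<longleftrightarrow>
    P \<in> Ob C \<and> (\<forall>i \<in> I. p i \<in> Hom C P (X i)) \<and>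
    (\<forall>Q q. Q \<in> Ob C \<longrightarrow> (\<forall>i \<in> I. q i \<in> Hom C Q (X i)) \<longrightarrow>
      (\<exists>!h. h \<in> Hom C Q P \<and> (\<forall>i \<in> I. p i \<cdot>\<^bsub>C\<^esub> h = q i)))"

definition is_coproduct ::
  "('o, 'm, 'z) cat_scheme \<Rightarrow> 'i set \<Rightarrow> ('i \<Rightarrow> 'o) \<Rightarrow> 'o \<Rightarrow> ('i \<Rightarrow> 'm) \<Rightarrow> bool" where
  "is_coproduct C I X P e \<longleftrightarrow>
    P \<in> Ob C \<and> (\<forall>i \<in> I. e i \<in> Hom C (X i) P) \<and>
    (\<forall>Q q. Q \<in> Ob C \<longrightarrow> (\<forall>i \<in> I. q i \<in> Hom C (X i) Q) \<longrightarrow>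
      (\<exists>!h. h \<in> Hom C P Q \<and> (\<forall>i \<in> I. h \<cdot>\<^bsub>C\<^esub> e i = q i)))"

text \<open>
  Every small set is equipotent to a set of elements of the type underlying \<open>\<kappa>\<close>, so it
  suffices to index small families by sets over that type.
\<close>

definition has_small_products :: "'u rel \<Rightarrow> ('o, 'm, 'z) cat_scheme \<Rightarrow> bool" where
  "has_small_products \<kappa> C \<longleftrightarrow>
    (\<forall>(I :: 'u set) X. small \<kappa> I \<longrightarrow> (\<forall>i \<in> I. X i \<in> Ob C) \<longrightarrow> (\<exists>P p. is_product C I X P p))"

definition has_small_coproducts :: "'u rel \<Rightarrow> ('o, 'm, 'z) cat_scheme \<Rightarrow> bool" where
  "has_small_coproducts \<kappa> C \<longleftrightarrow>
    (\<forall>(I :: 'u set) X. small \<kappa> I \<longrightarrow> (\<forall>i \<in> I. X i \<in> Ob C) \<longrightarrow> (\<exists>P e. is_coproduct C I X P e))"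

definition is_generator :: "('o, 'm, 'z) cat_scheme \<Rightarrow> 'o \<Rightarrow> bool" where
  "is_generator C G \<longleftrightarrow>
    G \<in> Ob C \<and>
    (\<forall>X Y f g. f \<in> Hom C X Y \<longrightarrow> g \<in> Hom C X Y \<longrightarrow>
      (\<forall>h \<in> Hom C G X. f \<cdot>\<^bsub>C\<^esub> h = g \<cdot>\<^bsub>C\<^esub> h) \<longrightarrow> f = g)"

definition is_mono :: "('o, 'm, 'z) cat_scheme \<Rightarrow> 'm \<Rightarrow> bool" where
  "is_mono C f \<longleftrightarrow>
    f \<in> Arr C \<and>
    (\<forall>W g h. g \<in> Hom C W (Dom C f) \<longrightarrow> h \<in> Hom C W (Dom C f) \<longrightarrow> f \<cdot>\<^bsub>C\<^esub> g = f \<cdot>\<^bsub>C\<^esub> h \<longrightarrow> g = h)"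

definition is_epi :: "('o, 'm, 'z) cat_scheme \<Rightarrow> 'm \<Rightarrow> bool" where
  "is_epi C f \<longleftrightarrow>
    f \<in> Arr C \<and>
    (\<forall>W g h. g \<in> Hom C (Cod C f) W \<longrightarrow> h \<in> Hom C (Cod C f) W \<longrightarrow> g \<cdot>\<^bsub>C\<^esub> f = h \<cdot>\<^bsub>C\<^esub> f \<longrightarrow> g = h)"

definition is_zero_object :: "('o, 'm, 'z) cat_scheme \<Rightarrow> 'o \<Rightarrow> bool" where
  "is_zero_object C Z \<longleftrightarrow>
    Z \<in> Ob C \<and> (\<forall>X \<in> Ob C. (\<exists>!f. f \<in> Hom C X Z) \<and> (\<exists>!f. f \<in> Hom C Z X))"


section \<open>Abelian categories\<close>

record ('o, 'm) ab_cat = "('o, 'm) cat" +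
  Add :: "'m \<Rightarrow> 'm \<Rightarrow> 'm"
  Zero :: "'o \<Rightarrow> 'o \<Rightarrow> 'm"

definition hom_group :: "('o, 'm, 'z) ab_cat_scheme \<Rightarrow> 'o \<Rightarrow> 'o \<Rightarrow> 'm monoid" where
  "hom_group C X Y = \<lparr>carrier = Hom C X Y, mult = Add C, one = Zero C X Y\<rparr>"

definition hom_diff :: "('o, 'm, 'z) ab_cat_scheme \<Rightarrow> 'm \<Rightarrow> 'm \<Rightarrow> 'm" where
  "hom_diff C f g = Add C f (inv\<^bsub>hom_group C (Dom C g) (Cod C g)\<^esub> g)"

definition preadditive_category :: "('o, 'm, 'z) ab_cat_scheme \<Rightarrow> bool" where
  "preadditive_category C \<longleftrightarrow>
    category C \<and>
    (\<forall>X \<in> Ob C. \<forall>Y \<in> Ob C. comm_group (hom_group C X Y)) \<and>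
    (\<forall>X Y Z f g h. f \<in> Hom C X Y \<longrightarrow> g \<in> Hom C Y Z \<longrightarrow> h \<in> Hom C Y Z \<longrightarrow>
       Add C g h \<cdot>\<^bsub>C\<^esub> f = Add C (g \<cdot>\<^bsub>C\<^esub> f) (h \<cdot>\<^bsub>C\<^esub> f)) \<and>
    (\<forall>X Y Z f g h. f \<in> Hom C X Y \<longrightarrow> g \<in> Hom C X Y \<longrightarrow> h \<in> Hom C Y Z \<longrightarrow>
       h \<cdot>\<^bsub>C\<^esub> Add C f g = Add C (h \<cdot>\<^bsub>C\<^esub> f) (h \<cdot>\<^bsub>C\<^esub> g))"

definition is_biproduct ::
  "('o, 'm, 'z) ab_cat_scheme \<Rightarrow> 'o \<Rightarrow> 'o \<Rightarrow> 'o \<Rightarrow> 'm \<Rightarrow> 'm \<Rightarrow> 'm \<Rightarrow> 'm \<Rightarrow> bool" where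
  "is_biproduct C X Y B p\<^sub>1 p\<^sub>2 i\<^sub>1 i\<^sub>2 \<longleftrightarrow>
    B \<in> Ob C \<and> p\<^sub>1 \<in> Hom C B X \<and> p\<^sub>2 \<in> Hom C B Y \<and> i\<^sub>1 \<in> Hom C X B \<and> i\<^sub>2 \<in> Hom C Y B \<and>
    p\<^sub>1 \<cdot>\<^bsub>C\<^esub> i\<^sub>1 = Idt C X \<and> p\<^sub>2 \<cdot>\<^bsub>C\<^esub> i\<^sub>2 = Idt C Y \<and>
    Add C (i\<^sub>1 \<cdot>\<^bsub>C\<^esub> p\<^sub>1) (i\<^sub>2 \<cdot>\<^bsub>C\<^esub> p\<^sub>2) = Idt C B"

definition is_kernel :: "('o, 'm, 'z) ab_cat_scheme \<Rightarrow> 'm \<Rightarrow> 'm \<Rightarrow> bool" where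
  "is_kernel C f k \<longleftrightarrow>
    f \<in> Arr C \<and> k \<in> Arr C \<and> Cod C k = Dom C f \<and>
    f \<cdot>\<^bsub>C\<^esub> k = Zero C (Dom C k) (Cod C f) \<and>
    (\<forall>W h. h \<in> Hom C W (Dom C f) \<longrightarrow> f \<cdot>\<^bsub>C\<^esub> h = Zero C W (Cod C f) \<longrightarrow>
      (\<exists>!u. u \<in> Hom C W (Dom C k) \<and> k \<cdot>\<^bsub>C\<^esub> u = h))"

definition is_cokernel :: "('o, 'm, 'z) ab_cat_scheme \<Rightarrow> 'm \<Rightarrow> 'm \<Rightarrow> bool" where
  "is_cokernel C f c \<longleftrightarrow>
    f \<in> Arr C \<and> c \<in> Arr C \<and> Dom C c = Cod C f \<and>
    c \<cdot>\<^bsub>C\<^esub> f = Zero C (Dom C f) (Cod C c) \<and>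
    (\<forall>W h. h \<in> Hom C (Cod C f) W \<longrightarrow> h \<cdot>\<^bsub>C\<^esub> f = Zero C (Dom C f) W \<longrightarrow>
      (\<exists>!u. u \<in> Hom C (Cod C c) W \<and> u \<cdot>\<^bsub>C\<^esub> c = h))"

definition abelian_category :: "('o, 'm, 'z) ab_cat_scheme \<Rightarrow> bool" where
  "abelian_category C \<longleftrightarrow>
    preadditive_category C \<and>
    (\<exists>Z. is_zero_object C Z) \<and>
    (\<forall>X \<in> Ob C. \<forall>Y \<in> Ob C. \<exists>B p\<^sub>1 p\<^sub>2 i\<^sub>1 i\<^sub>2. is_biproduct C X Y B p\<^sub>1 p\<^sub>2 i\<^sub>1 i\<^sub>2) \<and>
    (\<forall>f \<in> Arr C. (\<exists>k. is_kernel C f k) \<and> (\<exists>c. is_cokernel C f c)) \<and>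
    (\<forall>f. is_mono C f \<longrightarrow> (\<exists>g. is_kernel C g f)) \<and>
    (\<forall>f. is_epi C f \<longrightarrow> (\<exists>g. is_cokernel C g f))"

definition short_exact :: "('o, 'm, 'z) ab_cat_scheme \<Rightarrow> 'm \<Rightarrow> 'm \<Rightarrow> bool" where
  "short_exact C f g \<longleftrightarrow> is_kernel C g f \<and> is_cokernel C f g"

definition has_exact_small_products :: "'u rel \<Rightarrow> ('o, 'm, 'z) ab_cat_scheme \<Rightarrow> bool" where
  "has_exact_small_products \<kappa> C \<longleftrightarrow>
    has_small_products \<kappa> C \<and>
    (\<forall>(I :: 'u set) X Y Z f g P p Q q R r u v.
      small \<kappa> I \<longrightarrow>
      is_product C I X P p \<longrightarrow> is_product C I Y Q q \<longrightarrow> is_product C I Z R r \<longrightarrow>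
      (\<forall>i \<in> I. f i \<in> Hom C (X i) (Y i) \<and> g i \<in> Hom C (Y i) (Z i) \<and> short_exact C (f i) (g i)) \<longrightarrow>
      u \<in> Hom C P Q \<longrightarrow> (\<forall>i \<in> I. q i \<cdot>\<^bsub>C\<^esub> u = f i \<cdot>\<^bsub>C\<^esub> p i) \<longrightarrow>
      v \<in> Hom C Q R \<longrightarrow> (\<forall>i \<in> I. r i \<cdot>\<^bsub>C\<^esub> v = g i \<cdot>\<^bsub>C\<^esub> q i) \<longrightarrow>
      short_exact C u v)"


section \<open>Inverse sequences\<close>

text \<open>\<open>bond S i\<close> is the morphism from \<open>obj S (i + 1)\<close> to \<open>obj S i\<close>.\<close>

record ('o, 'm) inv_seq =
  obj :: "nat \<Rightarrow> 'o"
  bond :: "nat \<Rightarrow> 'm"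

definition inverse_sequence :: "('o, 'm, 'z) cat_scheme \<Rightarrow> ('o, 'm) inv_seq \<Rightarrow> bool" where
  "inverse_sequence C S \<longleftrightarrow>
    (\<forall>i. obj S i \<in> Ob C \<and> bond S i \<in> Hom C (obj S (Suc i)) (obj S i))"

text \<open>A morphism of inverse sequences is recorded together with its source and its target.\<close>

type_synonym ('o, 'm) seq_map = "('o, 'm) inv_seq \<times> (nat \<Rightarrow> 'm) \<times> ('o, 'm) inv_seq"

definition is_seq_map :: "('o, 'm, 'z) cat_scheme \<Rightarrow> ('o, 'm) seq_map \<Rightarrow> bool" where
  "is_seq_map C = (\<lambda>(S, \<phi>, T).
    inverse_sequence C S \<and> inverse_sequence C T \<and>
    (\<forall>i. \<phi> i \<in> Hom C (obj S i) (obj T i)) \<and>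
    (\<forall>i. \<phi> i \<cdot>\<^bsub>C\<^esub> bond S i = bond T i \<cdot>\<^bsub>C\<^esub> \<phi> (Suc i)))"

definition seq_category ::
  "('o, 'm, 'z) cat_scheme \<Rightarrow> (('o, 'm) inv_seq, ('o, 'm) seq_map) cat" where
  "seq_category C = \<lparr>
    Ob = {S. inverse_sequence C S},
    Arr = {\<Phi>. is_seq_map C \<Phi>},
    Dom = (\<lambda>(S, \<phi>, T). S),
    Cod = (\<lambda>(S, \<phi>, T). T),
    Idt = (\<lambda>S. (S, \<lambda>i. Idt C (obj S i), S)),
    Comp = (\<lambda>(T, \<psi>, U) (S, \<phi>, T'). (S, \<lambda>i. \<psi> i \<cdot>\<^bsub>C\<^esub> \<phi> i, U))\<rparr>"

text \<open>\<open>F\<close> is the endomorphism of the product \<open>P\<close> of the objects of \<open>S\<close> occurring in \<open>1 - F\<close>.\<close>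

definition is_seq_shift ::
  "('o, 'm, 'z) cat_scheme \<Rightarrow> ('o, 'm) inv_seq \<Rightarrow> 'o \<Rightarrow> (nat \<Rightarrow> 'm) \<Rightarrow> 'm \<Rightarrow> bool" where
  "is_seq_shift C S P pr F \<longleftrightarrow>
    is_product C UNIV (obj S) P pr \<and>
    F \<in> Hom C P P \<and> (\<forall>j. pr j \<cdot>\<^bsub>C\<^esub> F = bond S j \<cdot>\<^bsub>C\<^esub> pr (Suc j))"

definition is_seq_lim :: "('o, 'm, 'z) ab_cat_scheme \<Rightarrow> ('o, 'm) inv_seq \<Rightarrow> 'o \<Rightarrow> bool" where
  "is_seq_lim C S L \<longleftrightarrow>
    (\<exists>P pr F k. is_seq_shift C S P pr F \<and> is_kernel C (hom_diff C (Idt C P) F) k \<and> L = Dom C k)"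

definition is_seq_lim1 :: "('o, 'm, 'z) ab_cat_scheme \<Rightarrow> ('o, 'm) inv_seq \<Rightarrow> 'o \<Rightarrow> bool" where
  "is_seq_lim1 C S L \<longleftrightarrow>
    (\<exists>P pr F c. is_seq_shift C S P pr F \<and> is_cokernel C (hom_diff C (Idt C P) F) c \<and> L = Cod C c)"

text \<open>
  Both objects are determined up to isomorphism, so it does not matter which representatives
  are required to be zero.
\<close>

definition is_local :: "('o, 'm, 'z) ab_cat_scheme \<Rightarrow> ('o, 'm) inv_seq \<Rightarrow> bool" where
  "is_local C S \<longleftrightarrow>
    inverse_sequence C S \<and>
    (\<exists>L. is_seq_lim C S L \<and> is_zero_object C L) \<and>
    (\<exists>L. is_seq_lim1 C S L \<and> is_zero_object C L)"

end

theory Submission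
  imports Defs
begin

text \<open>
  By the Yoneda lemma, \<open>S\<close> is local iff for all \<open>X\<close> and all families \<open>y\<^sub>i : X \<rightarrow> S\<^sub>i\<close> the
  system \<open>x\<^sub>i - f\<^sub>i x\<^sub>i\<^sub>+\<^sub>1 = y\<^sub>i\<close> has a unique solution \<open>x\<^sub>i : X \<rightarrow> S\<^sub>i\<close>. Evaluation at \<open>i\<close> has a left
  adjoint, which sends \<open>X\<close> to the sequence that is \<open>X\<close> in degrees at most \<open>i\<close> and zero above, so
  limits of inverse sequences are pointwise. The solutions for the members of a diagram are
  compatible by uniqueness, hence assemble to the unique solution for its limit.
\<close>

section \<open>Arithmetic of morphisms in a preadditive category\<close>

locale preadditive =
  fixes C :: "('o, 'm, 'z) ab_cat_scheme" (structure)
  assumes preadd: "preadditive_category C"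
begin

lemma cat: "category C"
  by (rule preadd[unfolded preadditive_category_def, THEN conjunct1])

lemma Hom_Ob: "f \<in> Hom C X Y \<Longrightarrow> X \<in> Ob C" "f \<in> Hom C X Y \<Longrightarrow> Y \<in> Ob C"
  using cat[unfolded category_def, THEN conjunct1]
  unfolding Hom_def by blast+

lemma id_in: "X \<in> Ob C \<Longrightarrow> Idt C X \<in> Hom C X X"
  using cat[unfolded category_def, THEN conjunct2, THEN conjunct1] by blast

lemma comp_in: "f \<in> Hom C X Y \<Longrightarrow> g \<in> Hom C Y Z \<Longrightarrow> g \<cdot> f \<in> Hom C X Z"
  using cat[unfolded category_def, THEN conjunct2, THEN conjunct2, THEN conjunct1] by blast

lemma comp_id: "f \<in> Hom C X Y \<Longrightarrow> f \<cdot> Idt C X = f" "f \<in> Hom C X Y \<Longrightarrow> Idt C Y \<cdot> f = f"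
  using cat[unfolded category_def, THEN conjunct2, THEN conjunct2, THEN conjunct2, THEN conjunct1] by blast+

lemma assoc:
  "f \<in> Hom C W X \<Longrightarrow> g \<in> Hom C X Y \<Longrightarrow> h \<in> Hom C Y Z \<Longrightarrow> (h \<cdot> g) \<cdot> f = h \<cdot> (g \<cdot> f)"
  using cat[unfolded category_def, THEN conjunct2, THEN conjunct2, THEN conjunct2, THEN conjunct2] by blast

lemma hom_comm_group: "X \<in> Ob C \<Longrightarrow> Y \<in> Ob C \<Longrightarrow> comm_group (hom_group C X Y)"
  using preadd[unfolded preadditive_category_def, THEN conjunct2, THEN conjunct1] by blast

lemma Hom_comm_group: "f \<in> Hom C X Y \<Longrightarrow> comm_group (hom_group C X Y)"
  by (rule hom_comm_group[OF Hom_Ob])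

lemma comp_add_left:
  "f \<in> Hom C X Y \<Longrightarrow> g \<in> Hom C Y Z \<Longrightarrow> h \<in> Hom C Y Z \<Longrightarrow>
    Add C g h \<cdot> f = Add C (g \<cdot> f) (h \<cdot> f)"
  using preadd[unfolded preadditive_category_def, THEN conjunct2, THEN conjunct2, THEN conjunct1] by blast

lemma comp_add_right:
  "f \<in> Hom C X Y \<Longrightarrow> g \<in> Hom C X Y \<Longrightarrow> h \<in> Hom C Y Z \<Longrightarrow>
    h \<cdot> Add C f g = Add C (h \<cdot> f) (h \<cdot> g)"
  using preadd[unfolded preadditive_category_def, THEN conjunct2, THEN conjunct2, THEN conjunct2] by blast

lemma hom_group_simps:
  "carrier (hom_group C X Y) = Hom C X Y"
  "f \<otimes>\<^bsub>hom_group C X Y\<^esub> g = Add C f g"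
  "\<one>\<^bsub>hom_group C X Y\<^esub> = Zero C X Y"
  by (simp_all add: hom_group_def)

lemma add_in:
  assumes "f \<in> Hom C X Y" "g \<in> Hom C X Y" shows "Add C f g \<in> Hom C X Y"
proof -
  interpret comm_group "hom_group C X Y" by (rule Hom_comm_group[OF assms(1)])
  show ?thesis using m_closed[of f g] assms unfolding hom_group_simps by blast
qed

lemma zero_in:
  assumes "X \<in> Ob C" "Y \<in> Ob C" shows "Zero C X Y \<in> Hom C X Y"
proof -
  interpret comm_group "hom_group C X Y" by (rule hom_comm_group[OF assms])
  show ?thesis using one_closed unfolding hom_group_simps .
qed

lemma add_zero_left:
  assumes "f \<in> Hom C X Y" shows "Add C (Zero C X Y) f = f"
proof -
  interpret comm_group "hom_group C X Y" by (rule Hom_comm_group[OF assms])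
  show ?thesis using l_one[of f] assms unfolding hom_group_simps by blast
qed

lemma add_right_cancel:
  assumes "f \<in> Hom C X Y" "g \<in> Hom C X Y" "h \<in> Hom C X Y"
  shows "Add C f h = Add C g h \<longleftrightarrow> f = g"
proof -
  interpret comm_group "hom_group C X Y" by (rule Hom_comm_group[OF assms(1)])
  show ?thesis using right_cancel[of h f g] assms unfolding hom_group_simps by blast
qed

lemma add_idem:
  assumes "f \<in> Hom C X Y" "Add C f f = f" shows "f = Zero C X Y"
  by (metis assms add_right_cancel add_zero_left zero_in Hom_Ob)

text \<open>Composition distributes over 0 + 0 = 0, so either composite is idempotent under
  addition, and the only idempotent of a group is its neutral element.\<close>

lemma comp_zero:
  assumes "f \<in> Hom C X Y" "W \<in> Ob C"
  shows "f \<cdot> Zero C W X = Zero C W Y" "Zero C Y W \<cdot> f = Zero C X W"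
proof -
  have X: "X \<in> Ob C" and Y: "Y \<in> Ob C" using Hom_Ob assms(1) by auto
  have z: "Zero C W X \<in> Hom C W X" "Zero C Y W \<in> Hom C Y W" by (rule zero_in; fact)+
  show "f \<cdot> Zero C W X = Zero C W Y"
    using comp_add_right[OF z(1) z(1) assms(1)] add_zero_left[OF z(1)]
    by (intro add_idem comp_in[OF z(1) assms(1)]) simp
  show "Zero C Y W \<cdot> f = Zero C X W"
    using comp_add_left[OF assms(1) z(2) z(2)] add_zero_left[OF z(2)]
    by (intro add_idem comp_in[OF assms(1) z(2)]) simp
qed

text \<open>\<open>hom_diff\<close> takes the inverse in the group read off from the domain and
  codomain of its second argument. Later arguments about differences rest on these two facts and on
  cancellation, never on inverses.\<close>

lemma diff:
  assumes "f \<in> Hom C X Y" "g \<in> Hom C X Y"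
  shows diff_in: "hom_diff C f g \<in> Hom C X Y" and diff_add: "Add C (hom_diff C f g) g = f"
proof -
  interpret G: comm_group "hom_group C X Y" by (rule Hom_comm_group[OF assms(1)])
  have g': "inv\<^bsub>hom_group C X Y\<^esub> g \<in> Hom C X Y"
    and inv: "Add C (inv\<^bsub>hom_group C X Y\<^esub> g) g = Zero C X Y"
    using G.inv_closed[of g] G.l_inv[of g] assms unfolding hom_group_simps by blast+
  have d: "hom_diff C f g = Add C f (inv\<^bsub>hom_group C X Y\<^esub> g)"
    using assms unfolding hom_diff_def Hom_def by auto
  show "hom_diff C f g \<in> Hom C X Y" unfolding d by (rule add_in[OF assms(1) g'])
  show "Add C (hom_diff C f g) g = f"
    using G.m_assoc[OF _ _ _, of f "inv\<^bsub>hom_group C X Y\<^esub> g" g] G.r_one[of f] assms g' inv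
    unfolding d hom_group_simps by metis
qed

text \<open>Composing (1 - F) + F = 1 with \<open>h\<close> gives h = (1 - F) h + F h, and F h can
  be cancelled. This trades the difference for the sum that occurs in
  \<open>is_solution\<close>.\<close>

lemma diff_id_comp_eq_iff:
  assumes "F \<in> Hom C P P" "h \<in> Hom C X P" "g \<in> Hom C X P"
  shows "hom_diff C (Idt C P) F \<cdot> h = g \<longleftrightarrow> h = Add C g (F \<cdot> h)"
proof -
  have i: "Idt C P \<in> Hom C P P" by (rule id_in[OF Hom_Ob(1)[OF assms(1)]])
  have d: "hom_diff C (Idt C P) F \<in> Hom C P P" by (rule diff_in[OF i assms(1)])
  have "h = Add C (hom_diff C (Idt C P) F) F \<cdot> h"
    using diff_add[OF i assms(1)] comp_id assms by simp
  also have "\<dots> = Add C (hom_diff C (Idt C P) F \<cdot> h) (F \<cdot> h)"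
    by (rule comp_add_left[OF assms(2) d assms(1)])
  finally show ?thesis
    using add_right_cancel[OF comp_in[OF assms(2) d] assms(3) comp_in[OF assms(2,1)]] by simp
qed

lemma zero_object_Hom_eq:
  assumes "is_zero_object C Z"
  shows "f \<in> Hom C X Z \<Longrightarrow> g \<in> Hom C X Z \<Longrightarrow> f = g"
    and "f \<in> Hom C Z X \<Longrightarrow> g \<in> Hom C Z X \<Longrightarrow> f = g"
  using assms Hom_Ob unfolding is_zero_object_def by metis+

section \<open>Vanishing kernels and cokernels\<close>

lemma kernel_lift:
  assumes "is_kernel C f k" "f \<in> Hom C X Y" "h \<in> Hom C W X" "f \<cdot> h = Zero C W Y"
  obtains u where "u \<in> Hom C W (Dom C k)" "k \<cdot> u = h"
proof -
  have "Dom C f = X" "Cod C f = Y" using assms(2) by (auto simp: Hom_def)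
  then have "\<exists>!u. u \<in> Hom C W (Dom C k) \<and> k \<cdot> u = h"
    using assms(1,3,4) unfolding is_kernel_def by simp
  then show thesis using that by blast
qed

lemma cokernel_lift:
  assumes "is_cokernel C f c" "f \<in> Hom C X Y" "h \<in> Hom C Y W" "h \<cdot> f = Zero C X W"
  obtains u where "u \<in> Hom C (Cod C c) W" "u \<cdot> c = h"
proof -
  have "Dom C f = X" "Cod C f = Y" using assms(2) by (auto simp: Hom_def)
  then have "\<exists>!u. u \<in> Hom C (Cod C c) W \<and> u \<cdot> c = h"
    using assms(1,3,4) unfolding is_cokernel_def by simp
  then show thesis using that by blast
qed

text \<open>The difference of \<open>h\<close> and \<open>h'\<close> is killed by \<open>f\<close>,
  hence factors through the kernel object; a morphism through a zero object is zero.\<close>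

lemma kernel_zero_imp_cancel:
  assumes k: "is_kernel C f k" "is_zero_object C (Dom C k)" and f: "f \<in> Hom C X Y"
    and h: "h \<in> Hom C W X" "h' \<in> Hom C W X" and eq: "f \<cdot> h = f \<cdot> h'"
  shows "h = h'"
proof -
  have W: "W \<in> Ob C" and X: "X \<in> Ob C" and Y: "Y \<in> Ob C" by (rule Hom_Ob[OF h(1)] Hom_Ob[OF f])+
  let ?d = "hom_diff C h h'"
  have d: "?d \<in> Hom C W X" "Add C ?d h' = h" by (rule diff[OF h])+
  \<comment> \<open>Distributivity is stated for sums, so f d = 0 is obtained from f d + f h' = f h
    = f h' = 0 + f h' by cancellation.\<close>
  have "Add C (f \<cdot> ?d) (f \<cdot> h') = Add C (Zero C W Y) (f \<cdot> h')"
    using comp_add_right[OF d(1) h(2) f] d eq add_zero_left[OF comp_in[OF h(2) f]] by simp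
  then have "f \<cdot> ?d = Zero C W Y" using add_right_cancel[OF comp_in[OF d(1) f] zero_in[OF W Y] comp_in[OF h(2) f]] by simp
  then obtain u where u: "u \<in> Hom C W (Dom C k)" "k \<cdot> u = ?d"
    by (rule kernel_lift[OF k(1) f d(1)])
  have Z: "Dom C k \<in> Ob C" by (rule Hom_Ob(2)[OF u(1)])
  have kk: "k \<in> Hom C (Dom C k) X" using k(1) f by (auto simp: is_kernel_def Hom_def)
  have "u = Zero C W (Dom C k)" by (rule zero_object_Hom_eq(1)[OF k(2) u(1) zero_in[OF W Z]])
  then have "?d = Zero C W X" using u(2) comp_zero[OF kk W] by simp
  then show ?thesis using d(2) add_zero_left h by metis
qed

text \<open>Dual to \<open>kernel_zero_imp_cancel\<close>: the difference of two morphisms that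
  agree after \<open>f\<close> factors through the cokernel object.\<close>

lemma cokernel_zero_imp_epi:
  assumes c: "is_cokernel C f c" "is_zero_object C (Cod C c)" and f: "f \<in> Hom C X Y"
  shows "is_epi C f"
  unfolding is_epi_def
proof (intro conjI allI impI)
  show "f \<in> Arr C" using f by (simp add: Hom_def)
next
  fix W h h'
  assume "h \<in> Hom C (Cod C f) W" "h' \<in> Hom C (Cod C f) W" and eq: "h \<cdot> f = h' \<cdot> f"
  then have h: "h \<in> Hom C Y W" "h' \<in> Hom C Y W" using f by (auto simp: Hom_def)
  have W: "W \<in> Ob C" and X: "X \<in> Ob C" by (rule Hom_Ob[OF h(1)] Hom_Ob[OF f])+
  let ?d = "hom_diff C h h'"
  have d: "?d \<in> Hom C Y W" "Add C ?d h' = h" by (rule diff[OF h])+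
  have "Add C (?d \<cdot> f) (h' \<cdot> f) = Add C (Zero C X W) (h' \<cdot> f)"
    using comp_add_left[OF f d(1) h(2)] d eq add_zero_left[OF comp_in[OF f h(2)]] by simp
  then have "?d \<cdot> f = Zero C X W" using add_right_cancel[OF comp_in[OF f d(1)] zero_in[OF X W] comp_in[OF f h(2)]] by simp
  then obtain u where u: "u \<in> Hom C (Cod C c) W" "u \<cdot> c = ?d"
    by (rule cokernel_lift[OF c(1) f d(1)])
  have Z: "Cod C c \<in> Ob C" by (rule Hom_Ob(1)[OF u(1)])
  have cc: "c \<in> Hom C Y (Cod C c)" using c(1) f by (auto simp: is_cokernel_def Hom_def)
  have "u = Zero C (Cod C c) W" by (rule zero_object_Hom_eq(2)[OF c(2) u(1) zero_in[OF Z W]])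
  then have "?d = Zero C Y W" using u(2) comp_zero[OF cc W] by simp
  then show "h = h'" using d(2) add_zero_left h by metis
qed

text \<open>In an abelian category the monomorphism \<open>f\<close> is the kernel of some
  \<open>g\<close>. Since g f = 0 and \<open>f\<close> is epi, g = 0; so the identity of
  \<open>Y\<close> is killed by \<open>g\<close> and factors through \<open>f\<close>.\<close>

lemma mono_epi_imp_split:
  assumes ab: "abelian_category C" and f: "f \<in> Hom C X Y" and mono: "is_mono C f"
    and epi: "is_epi C f"
  shows "\<exists>s \<in> Hom C Y X. f \<cdot> s = Idt C Y"
proof -
  obtain g where g: "is_kernel C g f" using ab mono unfolding abelian_category_def by blast
  define W where "W = Cod C g"
  have gH: "g \<in> Hom C Y W" and gf: "g \<cdot> f = Zero C X W"
    using g f by (auto simp: is_kernel_def Hom_def W_def)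
  have W: "W \<in> Ob C" and X: "X \<in> Ob C" and Y: "Y \<in> Ob C" by (rule Hom_Ob[OF gH] Hom_Ob[OF f])+
  have fx: "Cod C f = Y" "Dom C f = X" using f by (auto simp: Hom_def)
  have "g = Zero C Y W"
    using epi gH gf comp_zero(2)[OF f W] zero_in[OF Y W] unfolding is_epi_def fx by metis
  then have "g \<cdot> Idt C Y = Zero C Y W" using comp_id(1)[OF gH] by simp
  then obtain s where "s \<in> Hom C Y (Dom C f)" "f \<cdot> s = Idt C Y"
    by (rule kernel_lift[OF g gH id_in[OF Y]])
  then show ?thesis using fx by auto
qed

section \<open>Morphisms into products\<close>

lemma productD:
  assumes "is_product C I X P p"
  shows "P \<in> Ob C" "i \<in> I \<Longrightarrow> p i \<in> Hom C P (X i)"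
  using assms unfolding is_product_def by (elim conjE, simp)+

lemma product_lift_ex1:
  assumes "is_product C I X P p" "Q \<in> Ob C" "\<And>i. i \<in> I \<Longrightarrow> q i \<in> Hom C Q (X i)"
  shows "\<exists>!h. h \<in> Hom C Q P \<and> (\<forall>i \<in> I. p i \<cdot> h = q i)"
  using assms unfolding is_product_def by simp

lemma product_ext:
  assumes "is_product C I X P p" "h \<in> Hom C Q P" "h' \<in> Hom C Q P"
    "\<And>i. i \<in> I \<Longrightarrow> p i \<cdot> h = p i \<cdot> h'"
  shows "h = h'"
proof -
  have "\<exists>!u. u \<in> Hom C Q P \<and> (\<forall>i \<in> I. p i \<cdot> u = p i \<cdot> h)"
    by (rule product_lift_ex1[OF assms(1) Hom_Ob(1)[OF assms(2)]
        comp_in[OF assms(2) productD(2)[OF assms(1)]]])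
  then show ?thesis using assms(2-4) by metis
qed

section \<open>Locality as unique solvability\<close>

definition is_solution :: "('o, 'm) inv_seq \<Rightarrow> 'o \<Rightarrow> (nat \<Rightarrow> 'm) \<Rightarrow> (nat \<Rightarrow> 'm) \<Rightarrow> bool" where
  "is_solution S X y x \<longleftrightarrow>
    (\<forall>i. x i \<in> Hom C X (obj S i)) \<and> (\<forall>i. x i = Add C (y i) (bond S i \<cdot> x (Suc i)))"

text \<open>No product is mentioned, so the condition can be carried from one product of the objects
  of \<open>S\<close> to another and tested on limits. Uniqueness of the function \<open>x\<close>
  is uniqueness of the family because all of \<open>nat\<close> is the index set.\<close>

definition uniquely_solvable :: "('o, 'm) inv_seq \<Rightarrow> bool" where
  "uniquely_solvable S \<longleftrightarrow>
    (\<forall>X y. X \<in> Ob C \<longrightarrow> (\<forall>i. y i \<in> Hom C X (obj S i)) \<longrightarrow> (\<exists>!x. is_solution S X y x))"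

lemma bond_in: "inverse_sequence C S \<Longrightarrow> bond S i \<in> Hom C (obj S (Suc i)) (obj S i)"
  unfolding inverse_sequence_def by blast

lemma seq_shiftD:
  assumes "is_seq_shift C S P pr F"
  shows "is_product C UNIV (obj S) P pr" "F \<in> Hom C P P" "pr j \<cdot> F = bond S j \<cdot> pr (Suc j)"
    "P \<in> Ob C" "pr j \<in> Hom C P (obj S j)" "hom_diff C (Idt C P) F \<in> Hom C P P"
proof -
  show P: "is_product C UNIV (obj S) P pr" and F: "F \<in> Hom C P P"
    and "pr j \<cdot> F = bond S j \<cdot> pr (Suc j)"
    using assms unfolding is_seq_shift_def by simp_all
  show "P \<in> Ob C" "pr j \<in> Hom C P (obj S j)" using productD[OF P] by simp_all
  then show "hom_diff C (Idt C P) F \<in> Hom C P P" using diff_in[OF id_in F] by simp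
qed

text \<open>Since pr_i F = f_i pr_(i+1), the equation of index i is the i-th component of h = g + F
  h, and morphisms into \<open>P\<close> are determined by their components.\<close>

lemma is_solution_iff:
  assumes S: "inverse_sequence C S" and sh: "is_seq_shift C S P pr F"
    and h: "h \<in> Hom C X P" and g: "g \<in> Hom C X P"
  shows "is_solution S X (\<lambda>i. pr i \<cdot> g) (\<lambda>i. pr i \<cdot> h) \<longleftrightarrow> hom_diff C (Idt C P) F \<cdot> h = g"
proof -
  note P = seq_shiftD(1)[OF sh] and F = seq_shiftD(2)[OF sh] and pr = seq_shiftD(5)[OF sh]
  have Fh: "F \<cdot> h \<in> Hom C X P" by (rule comp_in[OF h F])
  have "pr i \<cdot> (F \<cdot> h) = bond S i \<cdot> (pr (Suc i) \<cdot> h)" for i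
    using assoc[OF h F pr] assoc[OF h pr bond_in[OF S]] seq_shiftD(3)[OF sh] by simp
  then have *: "pr i \<cdot> Add C g (F \<cdot> h) = Add C (pr i \<cdot> g) (bond S i \<cdot> (pr (Suc i) \<cdot> h))" for i
    using comp_add_right[OF g Fh pr] by simp
  have "is_solution S X (\<lambda>i. pr i \<cdot> g) (\<lambda>i. pr i \<cdot> h) \<longleftrightarrow>
      (\<forall>i. pr i \<cdot> h = pr i \<cdot> Add C g (F \<cdot> h))"
    unfolding is_solution_def * using comp_in[OF h pr] by simp
  also have "\<dots> \<longleftrightarrow> h = Add C g (F \<cdot> h)"
    using product_ext[OF P h add_in[OF g Fh]] by auto
  finally show ?thesis using diff_id_comp_eq_iff[OF F h g] by simp
qed

text \<open>The conclusion is an equality of functions, so that a whole family can be rewritten as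
  the components of one morphism and fed to \<open>is_solution_iff\<close>.\<close>

lemma product_lift_family:
  assumes "is_product C UNIV X P p" "Q \<in> Ob C" "\<And>i. q i \<in> Hom C Q (X i)"
  obtains h where "h \<in> Hom C Q P" "q = (\<lambda>i. p i \<cdot> h)"
proof -
  have "\<exists>h. h \<in> Hom C Q P \<and> (\<forall>i. p i \<cdot> h = q i)"
    using product_lift_ex1[OF assms(1,2), of q] assms(3) by auto
  then obtain h where "h \<in> Hom C Q P" "\<forall>i. p i \<cdot> h = q i" by blast
  then show thesis by (intro that[of h]) auto
qed

lemma is_solution_in: "is_solution S X y x \<Longrightarrow> x i \<in> Hom C X (obj S i)"
  unfolding is_solution_def by blast

lemma uniquely_solvableD:
  assumes "uniquely_solvable S" "X \<in> Ob C" "\<And>i. y i \<in> Hom C X (obj S i)"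
  shows "\<exists>!x. is_solution S X y x"
  using assms unfolding uniquely_solvable_def by simp

text \<open>The vanishing of lim makes 1 - F mono and that of lim^1 makes it epi. In an abelian
  category it then has a section, which produces the solutions.\<close>

lemma local_imp_uniquely_solvable:
  assumes ab: "abelian_category C" and loc: "is_local C S"
  shows "uniquely_solvable S"
proof -
  have S: "inverse_sequence C S" using loc unfolding is_local_def by blast
  obtain P pr F k where sh: "is_seq_shift C S P pr F"
    and k: "is_kernel C (hom_diff C (Idt C P) F) k" "is_zero_object C (Dom C k)"
    using loc unfolding is_local_def is_seq_lim_def by blast
  \<comment> \<open>\<open>is_local\<close> may use different products for lim and lim^1, so the
    kernel belongs to \<open>P\<close> and the cokernel to \<open>P'\<close>.\<close>
  obtain P' pr' F' c where sh': "is_seq_shift C S P' pr' F'"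
    and c: "is_cokernel C (hom_diff C (Idt C P') F') c" "is_zero_object C (Cod C c)"
    using loc unfolding is_local_def is_seq_lim1_def by blast
  have uniq: "x = x'" if y: "\<And>i. y i \<in> Hom C X (obj S i)" and X: "X \<in> Ob C"
    and x: "is_solution S X y x" and x': "is_solution S X y x'" for X y x x'
  proof -
    note lift = product_lift_family[OF seq_shiftD(1)[OF sh] X]
    obtain g where g: "g \<in> Hom C X P" "y = (\<lambda>i. pr i \<cdot> g)" using lift[OF y] .
    obtain h where h: "h \<in> Hom C X P" "x = (\<lambda>i. pr i \<cdot> h)" using lift[OF is_solution_in[OF x]] .
    obtain h' where h': "h' \<in> Hom C X P" "x' = (\<lambda>i. pr i \<cdot> h')"
      using lift[OF is_solution_in[OF x']] .
    have "hom_diff C (Idt C P) F \<cdot> h = hom_diff C (Idt C P) F \<cdot> h'"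
      using is_solution_iff[OF S sh h(1) g(1)] is_solution_iff[OF S sh h'(1) g(1)] x x'
      unfolding g h h' by simp
    then have "h = h'" by (rule kernel_zero_imp_cancel[OF k seq_shiftD(6)[OF sh] h(1) h'(1)])
    then show ?thesis using h h' by simp
  qed
  let ?d = "hom_diff C (Idt C P') F'"
  note P' = seq_shiftD(1)[OF sh'] and pr' = seq_shiftD(5)[OF sh'] and d = seq_shiftD(6)[OF sh']
  \<comment> \<open>Uniqueness, proved by means of \<open>P\<close>, speaks only of families of
    components. It therefore also applies to components with respect to \<open>P'\<close>, where the
    epimorphism lives.\<close>
  have "is_mono C ?d"
    unfolding is_mono_def
  proof (intro conjI allI impI)
    show "?d \<in> Arr C" using d by (simp add: Hom_def)
  next
    fix W h h'
    assume "h \<in> Hom C W (Dom C ?d)" "h' \<in> Hom C W (Dom C ?d)" and eq: "?d \<cdot> h = ?d \<cdot> h'"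
    then have h: "h \<in> Hom C W P'" "h' \<in> Hom C W P'" using d by (auto simp: Hom_def)
    have g: "?d \<cdot> h \<in> Hom C W P'" by (rule comp_in[OF h(1) d])
    have "(\<lambda>i. pr' i \<cdot> h) = (\<lambda>i. pr' i \<cdot> h')"
    proof (rule uniq)
      show "pr' i \<cdot> (?d \<cdot> h) \<in> Hom C W (obj S i)" for i by (rule comp_in[OF g pr'])
      show "W \<in> Ob C" by (rule Hom_Ob(1)[OF h(1)])
      show "is_solution S W (\<lambda>i. pr' i \<cdot> (?d \<cdot> h)) (\<lambda>i. pr' i \<cdot> h)"
        using is_solution_iff[OF S sh' h(1) g] by simp
      show "is_solution S W (\<lambda>i. pr' i \<cdot> (?d \<cdot> h)) (\<lambda>i. pr' i \<cdot> h')"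
        using is_solution_iff[OF S sh' h(2) g] eq by simp
    qed
    then show "h = h'" using product_ext[OF P' h] by metis
  qed
  then obtain s where s: "s \<in> Hom C P' P'" "?d \<cdot> s = Idt C P'"
    using mono_epi_imp_split[OF ab d _ cokernel_zero_imp_epi[OF c d]] by blast
  show ?thesis
    unfolding uniquely_solvable_def
  proof (intro allI impI)
    fix X y
    assume X: "X \<in> Ob C" and y: "\<forall>i. y i \<in> Hom C X (obj S i)"
    obtain g where g: "g \<in> Hom C X P'" "y = (\<lambda>i. pr' i \<cdot> g)"
      using product_lift_family[OF P' X spec[OF y]] .
    \<comment> \<open>The section \<open>s\<close> of 1 - F' solves every system at once: the
      components of s g are a solution for the components of \<open>g\<close>.\<close>
    have sg: "s \<cdot> g \<in> Hom C X P'" by (rule comp_in[OF g(1) s(1)])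
    have "?d \<cdot> (s \<cdot> g) = g" using assoc[OF g(1) s(1) d] s comp_id(2)[OF g(1)] by simp
    then have "is_solution S X y (\<lambda>i. pr' i \<cdot> (s \<cdot> g))"
      using is_solution_iff[OF S sh' sg g(1)] g(2) by simp
    then show "\<exists>!x. is_solution S X y x" using uniq[OF spec[OF y] X] by blast
  qed
qed

text \<open>Unique solvability makes composition with 1 - F bijective on morphisms into
  \<open>P\<close>. Hence zero morphisms from and to \<open>Z\<close> serve as its kernel and
  cokernel.\<close>

lemma uniquely_solvable_imp_local:
  assumes Z: "is_zero_object C Z" and S: "inverse_sequence C S"
    and P: "is_product C UNIV (obj S) P pr" and us: "uniquely_solvable S"
  shows "is_local C S"
proof -
  note Po = productD(1)[OF P] and pr = productD(2)[OF P UNIV_I]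
  have Zo: "Z \<in> Ob C" using Z unfolding is_zero_object_def by simp
  obtain F where F: "F \<in> Hom C P P" "(\<lambda>i. bond S i \<cdot> pr (Suc i)) = (\<lambda>i. pr i \<cdot> F)"
    using product_lift_family[OF P Po comp_in[OF pr bond_in[OF S]]] .
  have sh: "is_seq_shift C S P pr F" using P F fun_cong[OF F(2)] unfolding is_seq_shift_def by simp
  let ?d = "hom_diff C (Idt C P) F"
  note d = seq_shiftD(6)[OF sh]
  have ex1: "\<exists>!h. h \<in> Hom C X P \<and> ?d \<cdot> h = g" if g: "g \<in> Hom C X P" for X g
  proof -
    note X = Hom_Ob(1)[OF g]
    have ex1: "\<exists>!x. is_solution S X (\<lambda>i. pr i \<cdot> g) x"
      by (rule uniquely_solvableD[OF us X comp_in[OF g pr]])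
    then obtain x where x: "is_solution S X (\<lambda>i. pr i \<cdot> g) x" by blast
    obtain h where h: "h \<in> Hom C X P" "x = (\<lambda>i. pr i \<cdot> h)"
      using product_lift_family[OF P X is_solution_in[OF x]] .
    have dh: "?d \<cdot> h = g" using x is_solution_iff[OF S sh h(1) g] h(2) by simp
    moreover have "h' = h" if h': "h' \<in> Hom C X P" "?d \<cdot> h' = g" for h'
    proof -
      have "(\<lambda>i. pr i \<cdot> h') = x" using ex1 x is_solution_iff[OF S sh h'(1) g] h'(2) by blast
      then show ?thesis using product_ext[OF P h'(1) h(1)] h(2) by metis
    qed
    ultimately show ?thesis using h(1) by blast
  qed
  \<comment> \<open>The universal case, with the identity of \<open>P\<close> as right-hand side,
    yields a right inverse. It shows below that a morphism killing 1 - F on the right is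
    zero.\<close>
  obtain s where s: "s \<in> Hom C P P" "?d \<cdot> s = Idt C P" using ex1[OF id_in[OF Po]] by blast
  let ?k = "Zero C Z P" and ?c = "Zero C P Z"
  have kc: "?k \<in> Hom C Z P" "?c \<in> Hom C P Z" by (rule zero_in[OF Zo Po] zero_in[OF Po Zo])+
  have dd: "?d \<in> Arr C" "Dom C ?d = P" "Cod C ?d = P"
    "?k \<in> Arr C" "Dom C ?k = Z" "Cod C ?k = P" "?c \<in> Arr C" "Dom C ?c = P" "Cod C ?c = Z"
    using d kc by (auto simp: Hom_def)
  have "is_kernel C ?d ?k"
    unfolding is_kernel_def dd
  proof (intro conjI allI impI refl)
    show "?d \<in> Arr C" "?k \<in> Arr C" by fact+
    show "?d \<cdot> ?k = Zero C Z P" using comp_zero[OF d Zo] by simp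
    fix W h assume h: "h \<in> Hom C W P" "?d \<cdot> h = Zero C W P"
    have W: "W \<in> Ob C" by (rule Hom_Ob(1)[OF h(1)])
    have "h = Zero C W P"
      \<comment> \<open>Both \<open>h\<close> and the zero morphism solve the equation with
        right-hand side zero.\<close>
      using ex1[OF zero_in[OF W Po]] comp_zero(1)[OF d W] h zero_in[OF W Po] by metis
    then have "?k \<cdot> Zero C W Z = h" using comp_zero[OF kc(1) W] by simp
    then show "\<exists>!u. u \<in> Hom C W Z \<and> ?k \<cdot> u = h"
      using zero_object_Hom_eq(1)[OF Z] zero_in[OF W Zo] by metis
  qed
  moreover have "is_cokernel C ?d ?c"
    unfolding is_cokernel_def dd
  proof (intro conjI allI impI refl)
    show "?d \<in> Arr C" "?c \<in> Arr C" by fact+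
    show "?c \<cdot> ?d = Zero C P Z" using comp_zero[OF d Zo] by simp
    fix W h assume h: "h \<in> Hom C P W" "h \<cdot> ?d = Zero C P W"
    have W: "W \<in> Ob C" by (rule Hom_Ob(2)[OF h(1)])
    have "h = (h \<cdot> ?d) \<cdot> s" using assoc[OF s(1) d h(1)] s(2) comp_id(1)[OF h(1)] by simp
    then have "h = Zero C P W" using comp_zero[OF s(1) W] h by simp
    then have "Zero C Z W \<cdot> ?c = h" using comp_zero[OF kc(2) W] by simp
    then show "\<exists>!u. u \<in> Hom C Z W \<and> u \<cdot> ?c = h"
      using zero_object_Hom_eq(2)[OF Z] zero_in[OF Zo W] by metis
  qed
  ultimately show ?thesis
    using S sh Z dd unfolding is_local_def is_seq_lim_def is_seq_lim1_def by metis
qed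

section \<open>Extending a morphism in one degree to a morphism of sequences\<close>

text \<open>The bond of index n starts in degree n + 1, so identities occur for n < i only. At n = i
  it runs from \<open>Z\<close> to \<open>X\<close>, and beyond that from \<open>Z\<close> to
  \<open>Z\<close>; hence the inner conditional.\<close>

definition truncated_seq :: "'o \<Rightarrow> 'o \<Rightarrow> nat \<Rightarrow> ('o, 'm) inv_seq" where
  "truncated_seq Z X i = \<lparr>
    obj = (\<lambda>n. if n \<le> i then X else Z),
    bond = (\<lambda>n. if n < i then Idt C X else Zero C Z (if n \<le> i then X else Z))\<rparr>"

text \<open>The recursion runs over the distance travelled down from degree \<open>i\<close>: the
  value at d is f_(i-d) ... f_(i-1) x. It is meaningful for d at most \<open>i\<close>, where the
  subtraction is not cut off.\<close>

primrec descend :: "('o, 'm) inv_seq \<Rightarrow> nat \<Rightarrow> 'm \<Rightarrow> nat \<Rightarrow> 'm" where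
  "descend S i x 0 = x"
| "descend S i x (Suc d) = bond S (i - Suc d) \<cdot> descend S i x d"

text \<open>The adjunct of \<open>x : X \<rightarrow> S\<^sub>i\<close>.\<close>

definition extend :: "'o \<Rightarrow> ('o, 'm) inv_seq \<Rightarrow> nat \<Rightarrow> 'o \<Rightarrow> 'm \<Rightarrow> ('o, 'm) seq_map" where
  "extend Z S i X x =
    (truncated_seq Z X i, \<lambda>n. if n \<le> i then descend S i x (i - n) else Zero C Z (obj S n), S)"

lemma descend_in:
  assumes S: "inverse_sequence C S" and x: "x \<in> Hom C X (obj S i)" and "d \<le> i"
  shows "descend S i x d \<in> Hom C X (obj S (i - d))"
  using \<open>d \<le> i\<close>
proof (induction d)
  case (Suc d)
  then have "Suc (i - Suc d) = i - d" by simp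
  then show ?case using Suc comp_in[OF _ bond_in[OF S, of "i - Suc d"]] by simp
qed (use x in simp)

lemma truncated_seq: "X \<in> Ob C \<Longrightarrow> Z \<in> Ob C \<Longrightarrow> inverse_sequence C (truncated_seq Z X i)"
  unfolding inverse_sequence_def truncated_seq_def by (auto intro: id_in zero_in)

lemma extend_seq_map:
  assumes S: "inverse_sequence C S" and x: "x \<in> Hom C X (obj S i)" and Z: "Z \<in> Ob C"
  shows "is_seq_map C (extend Z S i X x)"
proof -
  note X = Hom_Ob(1)[OF x]
  have So: "\<And>n. obj S n \<in> Ob C" using S unfolding inverse_sequence_def by simp
  let ?\<phi> = "\<lambda>n. if n \<le> i then descend S i x (i - n) else Zero C Z (obj S n)"
  have \<phi>: "?\<phi> n \<in> Hom C (obj (truncated_seq Z X i) n) (obj S n)" for n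
    using descend_in[OF S x, of "i - n"] Z So by (auto simp: truncated_seq_def intro: zero_in)
  have "?\<phi> n \<cdot> bond (truncated_seq Z X i) n = bond S n \<cdot> ?\<phi> (Suc n)" for n
  proof (cases "n < i")
    case True
    \<comment> \<open>Below degree \<open>i\<close> the descent to degree n is the one to n + 1
      followed by the bond of index n.\<close>
    then have "i - n = Suc (i - Suc n)" "i - Suc (i - Suc n) = n" by auto
    then show ?thesis
      using True \<phi>[of n] comp_id by (simp add: truncated_seq_def)
  next
    case False
    \<comment> \<open>Here the source in degree n + 1 is \<open>Z\<close>, and both sides of the
      square are zero.\<close>
    then have "bond (truncated_seq Z X i) n = Zero C Z (obj (truncated_seq Z X i) n)"
      by (simp add: truncated_seq_def)
    then have "?\<phi> n \<cdot> bond (truncated_seq Z X i) n = Zero C Z (obj S n)"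
      using comp_zero(1)[OF \<phi> Z] by simp
    moreover have "bond S n \<cdot> ?\<phi> (Suc n) = Zero C Z (obj S n)"
      using False comp_zero(1)[OF bond_in[OF S] Z] by simp
    ultimately show ?thesis by simp
  qed
  then show ?thesis
    unfolding extend_def is_seq_map_def using \<phi> S truncated_seq[OF X Z] by simp
qed

lemma is_seq_mapD:
  assumes "is_seq_map C (S, \<phi>, T)"
  shows "inverse_sequence C S" "inverse_sequence C T" "\<phi> n \<in> Hom C (obj S n) (obj T n)"
    "\<phi> n \<cdot> bond S n = bond T n \<cdot> \<phi> (Suc n)"
  using assms unfolding is_seq_map_def by simp_all

text \<open>Naturality of the adjunction in the sequence. The squares of a morphism of sequences
  move it past the bonds in \<open>descend\<close> one at a time; above degree \<open>i\<close> both
  sides vanish.\<close>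

lemma comp_extend:
  assumes f: "is_seq_map C (S, \<phi>, T)" and x: "x \<in> Hom C X (obj S i)" and Z: "Z \<in> Ob C"
  shows "(S, \<phi>, T) \<cdot>\<^bsub>seq_category C\<^esub> extend Z S i X x = extend Z T i X (\<phi> i \<cdot> x)"
proof -
  note S = is_seq_mapD(1)[OF f] and T = is_seq_mapD(2)[OF f] and \<phi> = is_seq_mapD(3)[OF f]
    and nat = is_seq_mapD(4)[OF f]
  have *: "d \<le> i \<Longrightarrow> \<phi> (i - d) \<cdot> descend S i x d = descend T i (\<phi> i \<cdot> x) d" for d
  proof (induction d)
    case (Suc d)
    let ?n = "i - Suc d"
    have n: "Suc ?n = i - d" using Suc by simp
    have x': "descend S i x d \<in> Hom C X (obj S (Suc ?n))"
      using descend_in[OF S x, of d] Suc n by simp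
    have "\<phi> ?n \<cdot> (bond S ?n \<cdot> descend S i x d) = bond T ?n \<cdot> (\<phi> (Suc ?n) \<cdot> descend S i x d)"
      using assoc[OF x' bond_in[OF S] \<phi>] assoc[OF x' \<phi> bond_in[OF T]] nat by simp
    then show ?case using Suc n by simp
  qed simp
  have "\<phi> n \<cdot> (if n \<le> i then descend S i x (i - n) else Zero C Z (obj S n)) =
      (if n \<le> i then descend T i (\<phi> i \<cdot> x) (i - n) else Zero C Z (obj T n))" for n
    using *[of "i - n"] comp_zero(1)[OF \<phi> Z] by (cases "n \<le> i") simp_all
  then show ?thesis unfolding extend_def seq_category_def by simp
qed

text \<open>Additivity distributes the morphism over each equation, and its squares carry it past
  the bonds. This is what makes solutions comparable along a diagram.\<close>

lemma is_solution_comp: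
  assumes f: "is_seq_map C (S, \<phi>, T)" and y: "\<And>i. y i \<in> Hom C X (obj S i)"
    and x: "is_solution S X y x"
  shows "is_solution T X (\<lambda>i. \<phi> i \<cdot> y i) (\<lambda>i. \<phi> i \<cdot> x i)"
proof -
  note S = is_seq_mapD(1)[OF f] and T = is_seq_mapD(2)[OF f] and \<phi> = is_seq_mapD(3)[OF f]
  note xH = is_solution_in[OF x]
  have "\<phi> i \<cdot> x i = Add C (\<phi> i \<cdot> y i) (bond T i \<cdot> (\<phi> (Suc i) \<cdot> x (Suc i)))" for i
  proof -
    have xe: "x i = Add C (y i) (bond S i \<cdot> x (Suc i))" using x unfolding is_solution_def by blast
    have "\<phi> i \<cdot> x i = Add C (\<phi> i \<cdot> y i) (\<phi> i \<cdot> (bond S i \<cdot> x (Suc i)))"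
      unfolding xe by (rule comp_add_right[OF y comp_in[OF xH bond_in[OF S]] \<phi>])
    moreover have "\<phi> i \<cdot> (bond S i \<cdot> x (Suc i)) = bond T i \<cdot> (\<phi> (Suc i) \<cdot> x (Suc i))"
      using assoc[OF xH bond_in[OF S] \<phi>] assoc[OF xH \<phi> bond_in[OF T]] is_seq_mapD(4)[OF f] by simp
    ultimately show ?thesis by simp
  qed
  then show ?thesis unfolding is_solution_def using comp_in[OF xH \<phi>] by blast
qed

section \<open>Limits of sequences in a single degree\<close>

lemma seq_Hom:
  "f \<in> Hom (seq_category C) S T \<longleftrightarrow> (\<exists>\<phi>. f = (S, \<phi>, T) \<and> is_seq_map C f)"
  unfolding Hom_def seq_category_def by (cases f) auto

lemma comp_seq_map:
  "(T, \<psi>, U) \<cdot>\<^bsub>seq_category C\<^esub> (S, \<phi>, T') = (S, \<lambda>i. \<psi> i \<cdot> \<phi> i, U)"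
  by (simp add: seq_category_def)

text \<open>Strips sources and targets from the triples, so that the later arguments take place in
  \<open>C\<close>, one degree at a time.\<close>

lemma diagram_cone_components:
  assumes J: "category J" and D: "is_functor J (seq_category C) D\<^sub>o D\<^sub>a"
    and cone: "is_cone J (seq_category C) D\<^sub>o D\<^sub>a S l"
  obtains d q where
    "\<And>j k a. a \<in> Hom J j k \<Longrightarrow> D\<^sub>a a = (D\<^sub>o j, d a, D\<^sub>o k) \<and> is_seq_map C (D\<^sub>o j, d a, D\<^sub>o k) \<and>
      j \<in> Ob J \<and> k \<in> Ob J"
    "\<And>j. j \<in> Ob J \<Longrightarrow> l j = (S, q j, D\<^sub>o j) \<and> is_seq_map C (S, q j, D\<^sub>o j)"
    "\<And>j k a i. a \<in> Hom J j k \<Longrightarrow> d a i \<cdot> q j i = q k i"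
proof -
  define d where "d a = fst (snd (D\<^sub>a a))" for a
  define q where "q j = fst (snd (l j))" for j
  have d: "D\<^sub>a a = (D\<^sub>o j, d a, D\<^sub>o k) \<and> is_seq_map C (D\<^sub>o j, d a, D\<^sub>o k) \<and> j \<in> Ob J \<and> k \<in> Ob J"
    if a: "a \<in> Hom J j k" for a j k
  proof -
    have "j \<in> Ob J" "k \<in> Ob J" using a J unfolding category_def Hom_def by auto
    moreover have "D\<^sub>a a \<in> Hom (seq_category C) (D\<^sub>o j) (D\<^sub>o k)"
      using D a unfolding is_functor_def by simp
    ultimately show ?thesis unfolding seq_Hom d_def by auto
  qed
  have l: "l j = (S, q j, D\<^sub>o j) \<and> is_seq_map C (S, q j, D\<^sub>o j)" if "j \<in> Ob J" for j
  proof -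
    have "l j \<in> Hom (seq_category C) S (D\<^sub>o j)" using cone that unfolding is_cone_def by simp
    then show ?thesis unfolding seq_Hom q_def by auto
  qed
  have "d a i \<cdot> q j i = q k i" if a: "a \<in> Hom J j k" for j k a i
  proof -
    have "D\<^sub>a a \<cdot>\<^bsub>seq_category C\<^esub> l j = l k" using cone a unfolding is_cone_def by simp
    then have "(\<lambda>i. d a i \<cdot> q j i) = q k"
      using d[OF a] l by (simp add: comp_seq_map)
    then show ?thesis by (rule fun_cong)
  qed
  then show thesis using that d l by blast
qed

text \<open>A cone in degree \<open>i\<close> extends to a cone of sequences from the truncated
  sequence. Its mediating morphism, read in degree \<open>i\<close>, gives existence; extending two
  candidates to mediating morphisms gives uniqueness.\<close>

lemma limit_pointwise:
  assumes Z: "Z \<in> Ob C"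
    and lim: "is_limit_cone J (seq_category C) D\<^sub>o D\<^sub>a S l"
    and d: "\<And>j k a. a \<in> Hom J j k \<Longrightarrow> D\<^sub>a a = (D\<^sub>o j, d a, D\<^sub>o k) \<and>
      is_seq_map C (D\<^sub>o j, d a, D\<^sub>o k) \<and> j \<in> Ob J \<and> k \<in> Ob J"
    and l: "\<And>j. j \<in> Ob J \<Longrightarrow> l j = (S, q j, D\<^sub>o j) \<and> is_seq_map C (S, q j, D\<^sub>o j)"
    and X: "X \<in> Ob C"
    and m: "\<And>j. j \<in> Ob J \<Longrightarrow> m j \<in> Hom C X (obj (D\<^sub>o j) i)"
    and mc: "\<And>j k a. a \<in> Hom J j k \<Longrightarrow> d a i \<cdot> m j = m k"
  shows "\<exists>!h. h \<in> Hom C X (obj S i) \<and> (\<forall>j \<in> Ob J. q j i \<cdot> h = m j)"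
proof -
  let ?E = "\<lambda>S. extend Z S i X"
  have Do: "inverse_sequence C (D\<^sub>o j)" if "j \<in> Ob J" for j
    using l[OF that] is_seq_mapD(2) by blast
  have So: "inverse_sequence C S"
    using lim unfolding is_limit_cone_def is_cone_def seq_category_def by simp
  have E: "?E T x \<in> Hom (seq_category C) (truncated_seq Z X i) T"
    if "inverse_sequence C T" "x \<in> Hom C X (obj T i)" for T x
    unfolding seq_Hom using extend_seq_map[OF that Z] by (simp add: extend_def)
  \<comment> \<open>In degree \<open>i\<close> the descent has length zero, so the extension returns
    \<open>x\<close> itself.\<close>
  have E_inj: "x = x'" if "?E T x = ?E T x'" for T x x'
  proof -
    have "fst (snd (?E T x)) i = fst (snd (?E T x')) i" using that by simp
    then show ?thesis by (simp add: extend_def)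
  qed
  have "is_cone J (seq_category C) D\<^sub>o D\<^sub>a (truncated_seq Z X i) (\<lambda>j. ?E (D\<^sub>o j) (m j))"
    unfolding is_cone_def
  proof (intro conjI ballI allI impI)
    show "truncated_seq Z X i \<in> Ob (seq_category C)"
      using truncated_seq[OF X Z] by (simp add: seq_category_def)
    show "?E (D\<^sub>o j) (m j) \<in> Hom (seq_category C) (truncated_seq Z X i) (D\<^sub>o j)" if "j \<in> Ob J" for j
      by (rule E[OF Do[OF that] m[OF that]])
    show "D\<^sub>a a \<cdot>\<^bsub>seq_category C\<^esub> ?E (D\<^sub>o j) (m j) = ?E (D\<^sub>o k) (m k)" if "a \<in> Hom J j k" for j k a
      using d[OF that] comp_extend[of "D\<^sub>o j" "d a" "D\<^sub>o k", OF _ m Z] mc[OF that] by simp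
  qed
  then have ex1: "\<exists>!h. h \<in> Hom (seq_category C) (truncated_seq Z X i) S \<and>
      (\<forall>j \<in> Ob J. l j \<cdot>\<^bsub>seq_category C\<^esub> h = ?E (D\<^sub>o j) (m j))"
    using lim unfolding is_limit_cone_def by simp
  then obtain H where H: "H \<in> Hom (seq_category C) (truncated_seq Z X i) S"
    and lH: "\<forall>j \<in> Ob J. l j \<cdot>\<^bsub>seq_category C\<^esub> H = ?E (D\<^sub>o j) (m j)" by blast
  obtain \<psi> where \<psi>: "H = (truncated_seq Z X i, \<psi>, S)" "is_seq_map C (truncated_seq Z X i, \<psi>, S)"
    using H unfolding seq_Hom by auto
  have h: "\<psi> i \<in> Hom C X (obj S i)"
    using is_seq_mapD(3)[OF \<psi>(2), of i] by (simp add: truncated_seq_def)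
  have "q j i \<cdot> \<psi> i = m j" if j: "j \<in> Ob J" for j
  proof -
    have "(\<lambda>n. q j n \<cdot> \<psi> n) = fst (snd (?E (D\<^sub>o j) (m j)))"
      using bspec[OF lH j] l[OF j] by (simp add: \<psi>(1) comp_seq_map extend_def)
    then have "q j i \<cdot> \<psi> i = fst (snd (?E (D\<^sub>o j) (m j))) i" by (rule fun_cong)
    then show ?thesis by (simp add: extend_def)
  qed
  moreover have "h' = h''"
    if h': "h' \<in> Hom C X (obj S i)" "\<forall>j \<in> Ob J. q j i \<cdot> h' = m j"
      and h'': "h'' \<in> Hom C X (obj S i)" "\<forall>j \<in> Ob J. q j i \<cdot> h'' = m j" for h' h''
  proof -
    have "l j \<cdot>\<^bsub>seq_category C\<^esub> ?E S u = ?E (D\<^sub>o j) (m j)"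
      if "u \<in> Hom C X (obj S i)" "\<forall>j \<in> Ob J. q j i \<cdot> u = m j" "j \<in> Ob J" for u j
      using comp_extend[of S "q j" "D\<^sub>o j", OF _ that(1) Z] l[OF that(3)] that(2,3) by simp
    then have "?E S h' = ?E S h''"
      using ex1 E[OF So h'(1)] E[OF So h''(1)] h' h'' by blast
    then show ?thesis by (rule E_inj)
  qed
  ultimately show ?thesis using h by blast
qed

section \<open>Unique solvability passes to limits\<close>

lemma uniquely_solvable_limit:
  assumes Z: "Z \<in> Ob C" and J: "category J" and D: "is_functor J (seq_category C) D\<^sub>o D\<^sub>a"
    and lim: "is_limit_cone J (seq_category C) D\<^sub>o D\<^sub>a S l"
    and us: "\<And>j. j \<in> Ob J \<Longrightarrow> uniquely_solvable (D\<^sub>o j)"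
  shows "uniquely_solvable S"
  unfolding uniquely_solvable_def
proof (intro allI impI)
  fix X y
  assume X: "X \<in> Ob C" and "\<forall>i. y i \<in> Hom C X (obj S i)"
  then have y: "\<And>i. y i \<in> Hom C X (obj S i)" by simp
  have cone: "is_cone J (seq_category C) D\<^sub>o D\<^sub>a S l" using lim unfolding is_limit_cone_def by simp
  then have S: "inverse_sequence C S" unfolding is_cone_def seq_category_def by simp
  obtain d q where
    d: "\<And>j k a. a \<in> Hom J j k \<Longrightarrow> D\<^sub>a a = (D\<^sub>o j, d a, D\<^sub>o k) \<and> is_seq_map C (D\<^sub>o j, d a, D\<^sub>o k) \<and>
      j \<in> Ob J \<and> k \<in> Ob J"
    and l: "\<And>j. j \<in> Ob J \<Longrightarrow> l j = (S, q j, D\<^sub>o j) \<and> is_seq_map C (S, q j, D\<^sub>o j)"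
    and dl: "\<And>j k a i. a \<in> Hom J j k \<Longrightarrow> d a i \<cdot> q j i = q k i"
    by (rule diagram_cone_components[OF J D cone]) (rule that)
  have pointwise: "\<exists>!h. h \<in> Hom C X (obj S i) \<and> (\<forall>j \<in> Ob J. q j i \<cdot> h = m j)"
    if "\<And>j. j \<in> Ob J \<Longrightarrow> m j \<in> Hom C X (obj (D\<^sub>o j) i)"
      "\<And>j k a. a \<in> Hom J j k \<Longrightarrow> d a i \<cdot> m j = m k" for m i
    by (rule limit_pointwise[OF Z lim _ _ X]) (fact d l that)+
  have lm: "is_seq_map C (S, q j, D\<^sub>o j)" if "j \<in> Ob J" for j using l[OF that] by simp
  have dm: "is_seq_map C (D\<^sub>o j, d a, D\<^sub>o k)" if "a \<in> Hom J j k" for a j k using d[OF that] by simp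
  note lH = is_seq_mapD(3)[OF lm] and dH = is_seq_mapD(3)[OF dm]
  have dlc: "d a i \<cdot> (q j i \<cdot> u) = q k i \<cdot> u"
    if a: "a \<in> Hom J j k" and u: "u \<in> Hom C X (obj S i)" for a j k i u
    using assoc[OF u lH dH[OF a]] d[OF a] dl[OF a] by simp
  \<comment> \<open>The projections are jointly monic in each degree: both morphisms mediate for the
    cone of the q_j u.\<close>
  have ext: "u = v" if u: "u \<in> Hom C X (obj S i)" and v: "v \<in> Hom C X (obj S i)"
    and uv: "\<And>j. j \<in> Ob J \<Longrightarrow> q j i \<cdot> u = q j i \<cdot> v" for u v i
  proof -
    have "\<exists>!h. h \<in> Hom C X (obj S i) \<and> (\<forall>j \<in> Ob J. q j i \<cdot> h = q j i \<cdot> u)"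
      by (rule pointwise[OF comp_in[OF u lH] dlc[OF _ u]])
    then show ?thesis using u v uv by metis
  qed
  have yj: "q j i \<cdot> y i \<in> Hom C X (obj (D\<^sub>o j) i)" if "j \<in> Ob J" for i j
    by (rule comp_in[OF y lH[OF that]])
  have ex1: "\<exists>!x. is_solution (D\<^sub>o j) X (\<lambda>i. q j i \<cdot> y i) x" if "j \<in> Ob J" for j
    by (rule uniquely_solvableD[OF us[OF that] X yj[OF that]])
  \<comment> \<open>The system over \<open>S\<close> is projected to each member of the diagram and
    solved there.\<close>
  define x where "x j = (THE x. is_solution (D\<^sub>o j) X (\<lambda>i. q j i \<cdot> y i) x)" for j
  have x: "is_solution (D\<^sub>o j) X (\<lambda>i. q j i \<cdot> y i) (x j)" if "j \<in> Ob J" for j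
    unfolding x_def by (rule theI'[OF ex1[OF that]])
  have xc: "d a i \<cdot> x j i = x k i" if a: "a \<in> Hom J j k" for a j k i
  proof -
    have jk: "j \<in> Ob J" "k \<in> Ob J" using d[OF a] by simp_all
    \<comment> \<open>Transport along \<open>a\<close> sends the right-hand side q_j y to q_k y, so
      the transported solution solves the system at \<open>k\<close>.\<close>
    have "is_solution (D\<^sub>o k) X (\<lambda>i. q k i \<cdot> y i) (\<lambda>i. d a i \<cdot> x j i)"
      using is_solution_comp[OF dm[OF a] yj[OF jk(1)] x[OF jk(1)]] dlc[OF a y] by simp
    then have "(\<lambda>i. d a i \<cdot> x j i) = x k" using ex1[OF jk(2)] x[OF jk(2)] by blast
    then show ?thesis by (rule fun_cong)
  qed
  have "\<exists>h. h \<in> Hom C X (obj S i) \<and> (\<forall>j \<in> Ob J. q j i \<cdot> h = x j i)" for i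
    by (rule ex1_implies_ex[OF pointwise[of "\<lambda>j. x j i", OF is_solution_in[OF x] xc]])
  then obtain h where h: "\<And>i. h i \<in> Hom C X (obj S i)"
    and lh: "\<And>i j. j \<in> Ob J \<Longrightarrow> q j i \<cdot> h i = x j i" by metis
  \<comment> \<open>In each degree \<open>h\<close> was assembled separately; that the bonds relate
    these degrees correctly is checked after every projection, where it is the equation for
    \<open>x j\<close>.\<close>
  have "h i = Add C (y i) (bond S i \<cdot> h (Suc i))" for i
  proof (rule ext[OF h])
    have bh: "bond S i \<cdot> h (Suc i) \<in> Hom C X (obj S i)" by (rule comp_in[OF h bond_in[OF S]])
    show "Add C (y i) (bond S i \<cdot> h (Suc i)) \<in> Hom C X (obj S i)" by (rule add_in[OF y bh])
    fix j assume j: "j \<in> Ob J"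
    note T = is_seq_mapD(2)[OF lm[OF j]]
    have "q j i \<cdot> (bond S i \<cdot> h (Suc i)) = bond (D\<^sub>o j) i \<cdot> x j (Suc i)"
      using assoc[OF h bond_in[OF S] lH[OF j]] assoc[OF h lH[OF j] bond_in[OF T]]
        is_seq_mapD(4)[OF lm[OF j]] lh[OF j] by simp
    then have "q j i \<cdot> Add C (y i) (bond S i \<cdot> h (Suc i)) =
        Add C (q j i \<cdot> y i) (bond (D\<^sub>o j) i \<cdot> x j (Suc i))"
      using comp_add_right[OF y bh lH[OF j]] by simp
    also have "\<dots> = x j i" using x[OF j] unfolding is_solution_def by metis
    finally show "q j i \<cdot> h i = q j i \<cdot> Add C (y i) (bond S i \<cdot> h (Suc i))" using lh[OF j] by simp
  qed
  then have "is_solution S X y h" unfolding is_solution_def using h by blast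
  moreover have "u = v" if u: "is_solution S X y u" and v: "is_solution S X y v" for u v
  proof
    fix i
    have "q j i \<cdot> u i = q j i \<cdot> v i" if j: "j \<in> Ob J" for j
    proof -
      have "(\<lambda>i. q j i \<cdot> u i) = (\<lambda>i. q j i \<cdot> v i)"
        using ex1[OF j] is_solution_comp[OF lm[OF j] y u] is_solution_comp[OF lm[OF j] y v] by blast
      then show ?thesis by (rule fun_cong)
    qed
    then show "u i = v i" by (rule ext[OF is_solution_in[OF u] is_solution_in[OF v]])
  qed
  ultimately show "\<exists>!x. is_solution S X y x" by blast
qed

end

section \<open>Countable products and the conclusion\<close>

text \<open>\<open>has_small_products\<close> speaks of index sets over the type of \<kappa>. Since
  \<kappa> is uncountable, the naturals embed into its field, and the product over the image of the
  embedding is reindexed.\<close>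

lemma countable_product:
  fixes \<kappa> :: "'u rel"
  assumes \<kappa>: "smallness_cardinal \<kappa>" and prod: "has_small_products \<kappa> C"
    and X: "\<forall>i :: nat. X i \<in> Ob C"
  shows "\<exists>P p. is_product C UNIV X P p"
proof -
  have co: "Card_order \<kappa>" and less: "natLeq <o \<kappa>"
    using \<kappa> unfolding smallness_cardinal_def by auto
  have small: "|UNIV :: nat set| <o \<kappa>" by (rule ordIso_ordLess_trans[OF card_of_nat less])
  then have "|UNIV :: nat set| \<le>o |Field \<kappa>|"
    by (rule ordLeq_ordIso_trans[OF ordLess_imp_ordLeq
        ordIso_symmetric[OF card_of_Field_ordIso[OF co]]])
  then have "\<exists>e :: nat \<Rightarrow> 'u. inj_on e UNIV \<and> e ` UNIV \<subseteq> Field \<kappa>"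
    by (rule iffD2[OF card_of_ordLeq])
  then obtain e :: "nat \<Rightarrow> 'u" where e: "inj e" by (elim exE conjE)
  have "|range e| <o \<kappa>"
    by (rule ordLeq_ordLess_trans[OF card_of_image small])
  then have "small \<kappa> (range e)" unfolding small_def .
  moreover have "\<forall>i \<in> range e. X (inv_into UNIV e i) \<in> Ob C" using X by simp
  ultimately obtain P p where P: "is_product C (range e) (\<lambda>i. X (inv_into UNIV e i)) P p"
    using prod[unfolded has_small_products_def, THEN spec[of _ "range e"],
        THEN spec[of _ "\<lambda>i. X (inv_into UNIV e i)"]]
    by blast
  have "is_product C UNIV X P (\<lambda>i. p (e i))"
    unfolding is_product_def
  proof (intro conjI ballI allI impI)
    show "P \<in> Ob C" using P unfolding is_product_def by (rule conjunct1)
    show "p (e i) \<in> Hom C P (X i)" for i using P e unfolding is_product_def by simp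
    fix Q q assume Q: "Q \<in> Ob C" "\<forall>i \<in> UNIV. q i \<in> Hom C Q (X i)"
    then have "\<forall>i \<in> range e. q (inv_into UNIV e i) \<in> Hom C Q (X (inv_into UNIV e i))" by simp
    then have "\<exists>!h. h \<in> Hom C Q P \<and> (\<forall>i \<in> range e. p i \<cdot>\<^bsub>C\<^esub> h = q (inv_into UNIV e i))"
      using P[unfolded is_product_def, THEN conjunct2, THEN conjunct2, THEN spec[of _ Q],
          THEN spec[of _ "\<lambda>i. q (inv_into UNIV e i)"]] Q(1)
      by simp
    then show "\<exists>!h. h \<in> Hom C Q P \<and> (\<forall>i \<in> UNIV. p (e i) \<cdot>\<^bsub>C\<^esub> h = q i)" using e by simp
  qed
  then show ?thesis by blast
qed

theorem corollary2p4:
  fixes \<kappa> :: "'u rel"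
    and A :: "('o, 'm, 'z) ab_cat_scheme"
    and J :: "('j, 'k, 'y) cat_scheme"
    and D\<^sub>o :: "'j \<Rightarrow> ('o, 'm) inv_seq"
    and D\<^sub>a :: "'k \<Rightarrow> ('o, 'm) seq_map"
    and S :: "('o, 'm) inv_seq"
    and l :: "'j \<Rightarrow> ('o, 'm) seq_map"
  assumes "smallness_cardinal \<kappa>"
    and "abelian_category A"
    and "\<exists>G. is_generator A G"
    and "has_small_coproducts \<kappa> A"
    and "has_exact_small_products \<kappa> A"
    and "small_category \<kappa> J"
    and "is_functor J (seq_category A) D\<^sub>o D\<^sub>a"
    and "\<forall>j \<in> Ob J. is_local A (D\<^sub>o j)"
    and "is_limit_cone J (seq_category A) D\<^sub>o D\<^sub>a S l"
  shows "is_local A S"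
proof -
  interpret preadditive A
    using assms(2) by unfold_locales (simp add: abelian_category_def)
  obtain Z where Z: "is_zero_object A Z" using assms(2) unfolding abelian_category_def by blast
  have S: "inverse_sequence A S"
    using assms(9) unfolding is_limit_cone_def is_cone_def seq_category_def by simp
  have "has_small_products \<kappa> A" using assms(5) unfolding has_exact_small_products_def by (rule conjunct1)
  moreover have "\<forall>i. obj S i \<in> Ob A" using S unfolding inverse_sequence_def by simp
  \<comment> \<open>Locality of \<open>S\<close> asserts that some product carries 1 - F, so a
    product of the objects of \<open>S\<close> has to be supplied.\<close>
  ultimately obtain P pr where P: "is_product A UNIV (obj S) P pr"
    using countable_product[OF assms(1)] by blast
  have "uniquely_solvable S"
  proof (rule uniquely_solvable_limit[OF _ _ assms(7) assms(9)])
    show "Z \<in> Ob A" using Z unfolding is_zero_object_def by (rule conjunct1)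
    show "category J" using assms(6) unfolding small_category_def by (rule conjunct1)
    show "uniquely_solvable (D\<^sub>o j)" if "j \<in> Ob J" for j
      using local_imp_uniquely_solvable[OF assms(2)] assms(8) that by simp
  qed
  then show ?thesis by (rule uniquely_solvable_imp_local[OF Z S P])
qed

end
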